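(* Let $X$ be a compact Hausdorff space. Then the following conditions are equivalent. (i) $\mathcal{U}(C(X))_u$ is bounded. (ii) $X$ is totally disconnected.
   Context: $C(X)$ is the $\mathrm{C}^*$-algebra of continuous complex-valued functions on $X$. For a unital $\mathrm{C}^*$-algebra $A$, $\mathcal{U}(A)_u$ is its unitary group equipped with the norm topology. A topological group $G$ is bounded if for every open neighborhood $V$ of the identity in $G$ there exist $n\in\mathbb{N}$ and a finite set $F\subset G$ such that $G=V^nF$. *)

theory Defs
  imports "HOL-Analysis.Analysis" "HOL-Algebra.Coset" "HOL-Algebra.Module"
begin

section \<open>Bounded topological groups\<close>

locale topological_group = group G for G (structure) +
  fixes T :: "'a topology"
  assumes topspace_eq: "topspace T = carrier G"
    and continuous_mult: "continuous_map (prod_topology T T) T (\<lambda>(x, y). x \<otimes> y)"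
    and continuous_inv: "continuous_map T T (\<lambda>x. inv x)"

primrec set_power :: "('a, 'b) monoid_scheme \<Rightarrow> 'a set \<Rightarrow> nat \<Rightarrow> 'a set" where
  "set_power G V 0 = {\<one>\<^bsub>G\<^esub>}"
| "set_power G V (Suc n) = V <#>\<^bsub>G\<^esub> set_power G V n"

definition (in topological_group) bounded_group :: bool where
  "bounded_group \<longleftrightarrow>
     (\<forall>V. openin T V \<and> \<one> \<in> V \<longrightarrow>
        (\<exists>n F. finite F \<and> F \<subseteq> carrier G \<and> carrier G = set_power G V n <#> F))"


section \<open>Unitary groups with the norm topology\<close>

text \<open>The operations of a unital C*-algebra: those of a complex algebra (the inherited ring and
  scalar multiplication fields) together with the involution and the norm.\<close>

record 'a cstar = "(complex, 'a) module" +
  star :: "'a \<Rightarrow> 'a"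
  cnorm :: "'a \<Rightarrow> real"

definition unitary_group :: "('a, 'b) cstar_scheme \<Rightarrow> 'a monoid" where
  "unitary_group A =
     \<lparr>carrier = {u \<in> carrier A. star A u \<otimes>\<^bsub>A\<^esub> u = \<one>\<^bsub>A\<^esub> \<and> u \<otimes>\<^bsub>A\<^esub> star A u = \<one>\<^bsub>A\<^esub>},
      mult = mult A, one = one A\<rparr>"

text \<open>Off the carrier the distance is set to 0, because the locale \<^locale>\<open>Metric_space\<close>
  asks for symmetry and nonnegativity on the whole type.\<close>

definition cstar_dist :: "('a, 'b) cstar_scheme \<Rightarrow> 'a \<Rightarrow> 'a \<Rightarrow> real" where
  "cstar_dist A a b =
     (if a \<in> carrier A \<and> b \<in> carrier A then cnorm A (a \<ominus>\<^bsub>A\<^esub> b) else 0)"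

definition cstar_topology :: "('a, 'b) cstar_scheme \<Rightarrow> 'a topology" where
  "cstar_topology A = Metric_space.mtopology (carrier A) (cstar_dist A)"

definition unitary_topology :: "('a, 'b) cstar_scheme \<Rightarrow> 'a topology" where
  "unitary_topology A = subtopology (cstar_topology A) (carrier (unitary_group A))"


section \<open>The C*-algebra of continuous functions on a compact space\<close>

text \<open>Functions on \<^term>\<open>topspace X\<close> are represented by functions on the whole type that are
  undefined off \<^term>\<open>topspace X\<close>, so that equality in the algebra is HOL equality.
  Inserting 0 in the supremum matters only when the space is empty (the zero algebra).\<close>

definition C_alg :: "'x topology \<Rightarrow> ('x \<Rightarrow> complex) cstar" where
  "C_alg X =
     \<lparr>carrier = {f \<in> extensional (topspace X). continuous_map X euclidean f},
      mult = (\<lambda>f g. \<lambda>x\<in>topspace X. f x * g x),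
      one = (\<lambda>x\<in>topspace X. 1),
      zero = (\<lambda>x\<in>topspace X. 0),
      add = (\<lambda>f g. \<lambda>x\<in>topspace X. f x + g x),
      smult = (\<lambda>c f. \<lambda>x\<in>topspace X. c * f x),
      star = (\<lambda>f. \<lambda>x\<in>topspace X. cnj (f x)),
      cnorm = (\<lambda>f. Sup (insert 0 ((\<lambda>x. cmod (f x)) ` topspace X)))\<rparr>"


section \<open>Total disconnectedness\<close>

definition totally_disconnected_space :: "'x topology \<Rightarrow> bool" where
  "totally_disconnected_space X \<longleftrightarrow> (\<forall>S. connectedin X S \<longrightarrow> (\<exists>a. S \<subseteq> {a}))"


section \<open>The unitary group of \<open>C(X)\<close> is a topological group\<close>

lemma C_alg_abelian_group: "abelian_group (C_alg X)"
proof (rule abelian_groupI)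
  fix f assume f: "f \<in> carrier (C_alg X)"
  have "continuous_map X euclidean (\<lambda>x\<in>topspace X. - f x)"
    by (rule continuous_map_eq[where f = "\<lambda>x. - f x"])
       (use f in \<open>auto simp: C_alg_def intro!: continuous_map_minus\<close>)
  then show "\<exists>g\<in>carrier (C_alg X). g \<oplus>\<^bsub>C_alg X\<^esub> f = \<zero>\<^bsub>C_alg X\<^esub>"
    by (intro bexI[where x = "\<lambda>x\<in>topspace X. - f x"]) (auto simp: C_alg_def fun_eq_iff)
next
  fix f g assume fg: "f \<in> carrier (C_alg X)" "g \<in> carrier (C_alg X)"
  have "continuous_map X euclidean (\<lambda>x\<in>topspace X. f x + g x)"
    by (rule continuous_map_eq[where f = "\<lambda>x. f x + g x"])
       (use fg in \<open>auto simp: C_alg_def intro!: continuous_map_add\<close>)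
  then show "f \<oplus>\<^bsub>C_alg X\<^esub> g \<in> carrier (C_alg X)"
    by (simp add: C_alg_def)
qed (auto simp: C_alg_def fun_eq_iff extensional_def algebra_simps
          intro: continuous_map_eq[where f = "\<lambda>x. 0"])

lemma C_alg_minus:
  assumes "f \<in> carrier (C_alg X)" "g \<in> carrier (C_alg X)"
  shows "f \<ominus>\<^bsub>C_alg X\<^esub> g = (\<lambda>x\<in>topspace X. f x - g x)"
proof -
  interpret abelian_group "C_alg X" by (rule C_alg_abelian_group)
  define h where "h = f \<ominus>\<^bsub>C_alg X\<^esub> g"
  have h: "h \<in> carrier (C_alg X)" using assms by (simp add: h_def)
  have "h \<oplus>\<^bsub>C_alg X\<^esub> g = f"
    using assms by (simp add: h_def a_minus_def a_assoc l_neg)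
  then have "h x + g x = f x" if "x \<in> topspace X" for x
    using that by (auto simp: C_alg_def fun_eq_iff dest: spec[of _ x])
  then show ?thesis
    using h unfolding h_def[symmetric]
    by (auto simp: C_alg_def fun_eq_iff extensional_def algebra_simps)
qed

lemma cstar_dist_C_alg_le_iff:
  assumes "compact_space X" "f \<in> carrier (C_alg X)" "g \<in> carrier (C_alg X)" "0 \<le> r"
  shows "cstar_dist (C_alg X) f g \<le> r \<longleftrightarrow> (\<forall>x\<in>topspace X. cmod (f x - g x) \<le> r)"
proof -
  let ?S = "(\<lambda>x. cmod (f x - g x)) ` topspace X"
  have "continuous_map X euclideanreal (\<lambda>x. cmod (f x - g x))"
    using assms by (intro continuous_map_norm continuous_map_diff) (auto simp: C_alg_def)
  then have "compactin euclideanreal ?S"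
    using assms(1) image_compactin compact_space_def by metis
  then have "bdd_above (insert 0 ?S)"
    by (simp add: compact_imp_bounded bounded_imp_bdd_above)
  moreover have "cstar_dist (C_alg X) f g = Sup (insert 0 ?S)"
    using assms(2,3) by (simp add: cstar_dist_def C_alg_minus) (simp add: C_alg_def)
  ultimately show ?thesis
    using assms(4) by (subst \<open>cstar_dist _ _ _ = _\<close>, subst cSup_le_iff) auto
qed

lemma C_alg_Metric_space:
  assumes X: "compact_space X"
  shows "Metric_space (carrier (C_alg X)) (cstar_dist (C_alg X))"
proof -
  let ?A = "C_alg X"
  let ?d = "cstar_dist ?A"
  note le = cstar_dist_C_alg_le_iff[OF X]
  have nonneg: "0 \<le> ?d f g" for f g
  proof (cases "f \<in> carrier ?A \<and> g \<in> carrier ?A")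
    case True
    show ?thesis
    proof (rule ccontr)
      assume neg: "\<not> 0 \<le> ?d f g"
      then have "\<forall>x\<in>topspace X. cmod (f x - g x) \<le> 0"
        using True le[of f g 0] by simp
      then have "(\<lambda>x. cmod (f x - g x)) ` topspace X \<subseteq> {0}" by auto
      then have "insert 0 ((\<lambda>x. cmod (f x - g x)) ` topspace X) = {0}" by blast
      moreover have "?d f g = Sup (insert 0 ((\<lambda>x. cmod (f x - g x)) ` topspace X))"
        using True by (simp add: cstar_dist_def C_alg_minus) (simp add: C_alg_def)
      ultimately have "?d f g = 0" by (metis cSup_singleton)
      with neg show False by simp
    qed
  qed (auto simp: cstar_dist_def)
  have pw: "cmod (f x - g x) \<le> ?d f g"
    if "f \<in> carrier ?A" "g \<in> carrier ?A" "x \<in> topspace X" for f g x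
    using le[OF that(1,2) nonneg[of f g]] that(3) by blast
  show ?thesis
  proof
    show "0 \<le> ?d f g" for f g by (rule nonneg)
    show "?d f g = ?d g f" for f g
    proof (cases "f \<in> carrier ?A \<and> g \<in> carrier ?A")
      case True
      then show ?thesis
        by (intro antisym) (metis le nonneg norm_minus_commute pw)+
    qed (auto simp: cstar_dist_def)
    show "?d f g = 0 \<longleftrightarrow> f = g" if fg: "f \<in> carrier ?A" "g \<in> carrier ?A" for f g
    proof -
      have "?d f g = 0 \<longleftrightarrow> ?d f g \<le> 0" using nonneg[of f g] by auto
      also have "\<dots> \<longleftrightarrow> (\<forall>x\<in>topspace X. f x = g x)"
        using le[OF fg, of 0] by simp
      also have "\<dots> \<longleftrightarrow> f = g"
        using fg by (auto simp: C_alg_def intro: extensionalityI)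
      finally show ?thesis .
    qed
    show "?d f h \<le> ?d f g + ?d g h"
      if fgh: "f \<in> carrier ?A" "g \<in> carrier ?A" "h \<in> carrier ?A" for f g h
    proof -
      have "cmod (f x - h x) \<le> ?d f g + ?d g h" if "x \<in> topspace X" for x
        using pw[OF fgh(1,2) that] pw[OF fgh(2,3) that] norm_triangle_ineq[of "f x - g x" "g x - h x"]
        by simp
      then show ?thesis using le[OF fgh(1,3)] nonneg[of f g] nonneg[of g h] by simp
    qed
  qed
qed

lemma C_alg_unitary_iff:
  "u \<in> carrier (unitary_group (C_alg X)) \<longleftrightarrow>
     u \<in> carrier (C_alg X) \<and> (\<forall>x\<in>topspace X. cmod (u x) = 1)"
proof -
  have "cnj z * z = 1 \<longleftrightarrow> cmod z = 1" for z
    by (metis complex_norm_square mult.commute norm_ge_zero of_real_1 of_real_eq_iff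
        one_power2 power2_eq_iff_nonneg zero_le_one)
  then show ?thesis
    by (auto simp: unitary_group_def C_alg_def fun_eq_iff mult.commute restrict_def)
qed

lemma C_alg_mult_closed:
  assumes "f \<in> carrier (C_alg X)" "g \<in> carrier (C_alg X)"
  shows "(\<lambda>x\<in>topspace X. f x * g x) \<in> carrier (C_alg X)"
proof -
  have "continuous_map X euclidean (\<lambda>x\<in>topspace X. f x * g x)"
    by (rule continuous_map_eq[where f = "\<lambda>x. f x * g x"])
       (use assms in \<open>auto simp: C_alg_def continuous_map_atin intro!: tendsto_mult\<close>)
  then show ?thesis by (simp add: C_alg_def)
qed

lemma C_alg_star_closed:
  assumes "f \<in> carrier (C_alg X)"
  shows "(\<lambda>x\<in>topspace X. cnj (f x)) \<in> carrier (C_alg X)"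
proof -
  have "continuous_map X euclidean (\<lambda>x\<in>topspace X. cnj (f x))"
    by (rule continuous_map_eq[where f = "\<lambda>x. cnj (f x)"])
       (use assms in \<open>auto simp: C_alg_def continuous_map_atin intro!: tendsto_cnj\<close>)
  then show ?thesis by (simp add: C_alg_def)
qed

lemma unitary_group_C_alg_simps:
  "mult (unitary_group (C_alg X)) f g = (\<lambda>x\<in>topspace X. f x * g x)"
  "one (unitary_group (C_alg X)) = (\<lambda>x\<in>topspace X. 1)"
  by (simp_all add: unitary_group_def C_alg_def)

lemma cnj_mult_unit: "cmod z = 1 \<Longrightarrow> cnj z * z = 1"
  by (metis complex_norm_square mult.commute of_real_1 one_power2)

lemma unitary_group_C_alg_group: "group (unitary_group (C_alg X))"
proof (rule groupI)
  show "\<one>\<^bsub>unitary_group (C_alg X)\<^esub> \<in> carrier (unitary_group (C_alg X))"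
    unfolding C_alg_unitary_iff unitary_group_C_alg_simps
    by (auto simp: C_alg_def intro: continuous_map_eq[where f = "\<lambda>x. 1"])
next
  fix u assume u: "u \<in> carrier (unitary_group (C_alg X))"
  then show "\<exists>v\<in>carrier (unitary_group (C_alg X)).
      v \<otimes>\<^bsub>unitary_group (C_alg X)\<^esub> u = \<one>\<^bsub>unitary_group (C_alg X)\<^esub>"
    by (intro bexI[where x = "\<lambda>x\<in>topspace X. cnj (u x)"])
       (auto simp: C_alg_unitary_iff unitary_group_C_alg_simps C_alg_star_closed cnj_mult_unit)
  show "\<one>\<^bsub>unitary_group (C_alg X)\<^esub> \<otimes>\<^bsub>unitary_group (C_alg X)\<^esub> u = u"
    using u unfolding C_alg_unitary_iff unitary_group_C_alg_simps
    by (auto simp: C_alg_def fun_eq_iff extensional_def)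
qed (auto simp: C_alg_unitary_iff unitary_group_C_alg_simps C_alg_mult_closed norm_mult
          fun_eq_iff mult.assoc)

lemma unitary_group_C_alg_inv:
  assumes "u \<in> carrier (unitary_group (C_alg X))"
  shows "inv\<^bsub>unitary_group (C_alg X)\<^esub> u = (\<lambda>x\<in>topspace X. cnj (u x))"
  using assms
  by (intro group.inv_equality[OF unitary_group_C_alg_group])
     (auto simp: C_alg_unitary_iff unitary_group_C_alg_simps C_alg_star_closed cnj_mult_unit)

lemma unitary_group_C_alg_topological_group:
  assumes X: "compact_space X"
  shows "topological_group (unitary_group (C_alg X)) (unitary_topology (C_alg X))"
proof -
  let ?A = "C_alg X"
  let ?U = "unitary_group ?A"
  let ?T = "unitary_topology ?A"
  interpret Metric_space "carrier ?A" "cstar_dist ?A" by (rule C_alg_Metric_space[OF X])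
  interpret U: group ?U by (rule unitary_group_C_alg_group)
  have T: "?T = subtopology mtopology (carrier ?U)"
    by (simp add: unitary_topology_def cstar_topology_def)
  have UA: "carrier ?U \<subseteq> carrier ?A" by (auto simp: unitary_group_def)
  have top: "topspace ?T = carrier ?U" using UA by (auto simp: T)
  have ball: "openin ?T (mball u e \<inter> carrier ?U)" for u e
    unfolding T openin_subtopology using openin_mball by blast
  note le = cstar_dist_C_alg_le_iff[OF X]
  have pw: "cmod (f x - g x) \<le> cstar_dist ?A f g"
    if "f \<in> carrier ?A" "g \<in> carrier ?A" "x \<in> topspace X" for f g x
    using le[OF that(1,2) nonneg[of f g]] that(3) by blast
  have inv_le: "cstar_dist ?A (inv\<^bsub>?U\<^esub> u) (inv\<^bsub>?U\<^esub> v) \<le> cstar_dist ?A u v"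
    if "u \<in> carrier ?U" "v \<in> carrier ?U" for u v
  proof -
    have "inv\<^bsub>?U\<^esub> u \<in> carrier ?A" "inv\<^bsub>?U\<^esub> v \<in> carrier ?A" "u \<in> carrier ?A" "v \<in> carrier ?A"
      using that UA U.inv_closed by blast+
    then show ?thesis
      by (subst le)
         (auto simp: unitary_group_C_alg_inv that pw simp flip: complex_cnj_diff)
  qed
  have mult_le: "cstar_dist ?A (u \<otimes>\<^bsub>?U\<^esub> v) (u' \<otimes>\<^bsub>?U\<^esub> v') \<le> cstar_dist ?A u u' + cstar_dist ?A v v'"
    if "u \<in> carrier ?U" "v \<in> carrier ?U" "u' \<in> carrier ?U" "v' \<in> carrier ?U" for u v u' v'
  proof -
    have A: "u \<otimes>\<^bsub>?U\<^esub> v \<in> carrier ?A" "u' \<otimes>\<^bsub>?U\<^esub> v' \<in> carrier ?A"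
      "u \<in> carrier ?A" "v \<in> carrier ?A" "u' \<in> carrier ?A" "v' \<in> carrier ?A"
      using that UA U.m_closed by blast+
    have "cmod (u x * v x - u' x * v' x) \<le> cstar_dist ?A u u' + cstar_dist ?A v v'"
      if x: "x \<in> topspace X" for x
    proof -
      have "u x * v x - u' x * v' x = (u x - u' x) * v x + u' x * (v x - v' x)"
        by (simp add: algebra_simps)
      then have "cmod (u x * v x - u' x * v' x) \<le>
          cmod (u x - u' x) * cmod (v x) + cmod (u' x) * cmod (v x - v' x)"
        by (metis norm_mult norm_triangle_ineq)
      moreover have "cmod (v x) = 1" "cmod (u' x) = 1"
        using \<open>v \<in> carrier ?U\<close> \<open>u' \<in> carrier ?U\<close> x by (auto simp: C_alg_unitary_iff)
      ultimately show ?thesis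
        using pw[OF A(3,5) x] pw[OF A(4,6) x] by simp
    qed
    then show ?thesis
      using A by (subst le) (auto simp: unitary_group_C_alg_simps)
  qed
  show ?thesis
  proof unfold_locales
    show "topspace ?T = carrier ?U" by (rule top)
    have "continuous_map ?T mtopology (\<lambda>u. inv\<^bsub>?U\<^esub> u)"
      unfolding continuous_map_to_metric
    proof (intro ballI allI impI)
      fix u and e :: real assume u: "u \<in> topspace ?T" and e: "0 < e"
      show "\<exists>W. openin ?T W \<and> u \<in> W \<and> (\<forall>v\<in>W. inv\<^bsub>?U\<^esub> v \<in> mball (inv\<^bsub>?U\<^esub> u) e)"
      proof (intro exI conjI ballI)
        show "openin ?T (mball u e \<inter> carrier ?U)" by (rule ball)
        show "u \<in> mball u e \<inter> carrier ?U" using u e UA by (auto simp: top)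
        fix v assume v: "v \<in> mball u e \<inter> carrier ?U"
        then have "inv\<^bsub>?U\<^esub> u \<in> carrier ?A" "inv\<^bsub>?U\<^esub> v \<in> carrier ?A"
          using u UA U.inv_closed by (auto simp: top)
        then show "inv\<^bsub>?U\<^esub> v \<in> mball (inv\<^bsub>?U\<^esub> u) e"
          using v u inv_le[of u v] by (auto simp: top)
      qed
    qed
    then show "continuous_map ?T ?T (\<lambda>u. inv\<^bsub>?U\<^esub> u)"
      by (subst (2) T) (auto simp: continuous_map_in_subtopology top)
    have "continuous_map (prod_topology ?T ?T) mtopology (\<lambda>(u, v). u \<otimes>\<^bsub>?U\<^esub> v)"
      unfolding continuous_map_to_metric
    proof (intro ballI allI impI)
      fix p and e :: real assume p: "p \<in> topspace (prod_topology ?T ?T)" and e: "0 < e"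
      obtain u v where uv: "p = (u, v)" "u \<in> carrier ?U" "v \<in> carrier ?U"
        using p by (auto simp: top)
      let ?B = "\<lambda>u. mball u (e/2) \<inter> carrier ?U"
      show "\<exists>W. openin (prod_topology ?T ?T) W \<and> p \<in> W \<and>
          (\<forall>q\<in>W. (case q of (u, v) \<Rightarrow> u \<otimes>\<^bsub>?U\<^esub> v) \<in> mball (case p of (u, v) \<Rightarrow> u \<otimes>\<^bsub>?U\<^esub> v) e)"
      proof (intro exI conjI ballI)
        show "openin (prod_topology ?T ?T) (?B u \<times> ?B v)"
          using ball by (simp add: openin_prod_Times_iff)
        show "p \<in> ?B u \<times> ?B v" using uv e UA by auto
        fix q assume "q \<in> ?B u \<times> ?B v"
        then obtain u' v' where q: "q = (u', v')" "u' \<in> ?B u" "v' \<in> ?B v" by auto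
        have "u \<otimes>\<^bsub>?U\<^esub> v \<in> carrier ?A" "u' \<otimes>\<^bsub>?U\<^esub> v' \<in> carrier ?A"
          using q uv UA U.m_closed by blast+
        then show "(case q of (u, v) \<Rightarrow> u \<otimes>\<^bsub>?U\<^esub> v) \<in> mball (case p of (u, v) \<Rightarrow> u \<otimes>\<^bsub>?U\<^esub> v) e"
          using q uv mult_le[of u v u' v'] by auto
      qed
    qed
    then show "continuous_map (prod_topology ?T ?T) ?T (\<lambda>(u, v). u \<otimes>\<^bsub>?U\<^esub> v)"
      by (subst (3) T) (auto simp: continuous_map_in_subtopology top)
  qed
qed

end

theory Submission
  imports Defs
begin

text \<open>
  A unitary of \<open>C(X)\<close> is a continuous map from \<open>X\<close> to the unit circle, so boundedness of the
  unitary group is a question about continuous logarithms, i.e. continuous real functions \<open>h\<close>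
  with \<open>u = cis \<circ> h\<close>.

  If \<open>X\<close> is totally disconnected, every unitary \<open>u\<close> has a logarithm bounded by \<open>2\<pi>\<close>: the disjoint
  closed sets where \<open>u = -1\<close> and where \<open>u = 1\<close> are separated by a clopen set, and on each of the
  two clopen pieces a single branch of the argument is continuous
  (\<open>continuous_argument_if_totally_disconnected\<close>). Hence \<open>u\<close> is the \<open>n\<close>-th power of
  \<open>cis \<circ> (h / n)\<close>, which is uniformly within \<open>2\<pi> / n\<close> of 1. The number \<open>n\<close> depends
  only on the given neighbourhood, so finitely many translates (in fact one) suffice.

  Conversely, a product of \<open>n\<close> unitaries close to 1 has a logarithm bounded by \<open>n\<pi>\<close>
  (\<open>set_power_bounded_argument\<close>). On a connected set two logarithms of the same function differ
  by a constant, so the oscillation of a logarithm between two points \<open>a\<close>, \<open>b\<close> of a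
  connected set depends on the unitary alone (\<open>cis_lift_increment_unique\<close>). With a Urysohn function
  \<open>f\<close> separating \<open>a\<close> from \<open>b\<close>, the unitaries \<open>cis \<circ> (t f)\<close> oscillate by \<open>t\<close>. If the
  group were \<open>V\<^sup>n F\<close> with \<open>F\<close> finite, two such unitaries with far apart parameters would lie in the
  same translate of \<open>V\<^sup>n\<close>, and their quotient would oscillate by more than the bound allows.
\<close>

section \<open>Continuous arguments of circle-valued functions\<close>

lemma continuous_map_compose_open:
  assumes "continuous_map X euclidean f" "continuous_on S g"
    "\<And>x. x \<in> topspace X \<Longrightarrow> f x \<in> S"
  shows "continuous_map X euclidean (\<lambda>x. g (f x))"
proof -
  have "continuous_map X (top_of_set S) f"
    using assms by (auto simp: continuous_map_in_subtopology)
  moreover have "continuous_map (top_of_set S) euclidean g"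
    using assms(2) by simp
  ultimately show ?thesis
    using continuous_map_compose[of X "top_of_set S" f euclidean g] by (simp add: o_def)
qed

lemma cis_Arg_unit: "cmod z = 1 \<Longrightarrow> cis (Arg z) = z"
  using cis_Arg[of z] by (cases "z = 0") (auto simp: sgn_div_norm)

lemma unit_not_nonpos_Real:
  assumes "cmod z = 1" "z \<noteq> -1"
  shows "z \<notin> \<real>\<^sub>\<le>\<^sub>0"
  using assms by (auto elim!: nonpos_Reals_cases)

lemma continuous_map_Arg_unit:
  assumes "continuous_map X euclidean u" "\<And>x. x \<in> topspace X \<Longrightarrow> cmod (u x) = 1 \<and> u x \<noteq> -1"
  shows "continuous_map X euclideanreal (\<lambda>x. Arg (u x))"
  using assms unit_not_nonpos_Real
  by (intro continuous_map_compose_open[OF assms(1) continuous_on_Arg]) auto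

lemma norm_cis_minus_one_le: "cmod (cis t - 1) \<le> \<bar>t\<bar>"
proof -
  have "cmod (cis t - 1) = 2 * \<bar>sin (t / 2)\<bar>"
    using dist_exp_i_1[of t] by (simp add: cis_conv_exp)
  also have "\<dots> \<le> \<bar>t\<bar>"
    using abs_sin_x_le_abs_x[of "t/2"] by simp
  finally show ?thesis .
qed

text \<open>In a compact Hausdorff space quasi-components are components, hence points here; compactness
  then upgrades the separation of points by clopen sets to a separation of closed sets.\<close>

lemma totally_disconnected_imp_separated_between:
  assumes X: "compact_space X" "Hausdorff_space X" and td: "totally_disconnected_space X"
    and "closedin X C" "closedin X D" "disjnt C D"
  shows "separated_between X C D"
proof -
  have cp: "compactin X C" "compactin X D"
    using assms closedin_compact_space by blast+
  have sub: "C \<subseteq> topspace X" "D \<subseteq> topspace X"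
    using assms closedin_subset by blast+
  have pts: "separated_between X {x} {y}" if "x \<in> C" "y \<in> D" for x y
  proof -
    have "x \<noteq> y" using that assms(6) by (auto simp: disjnt_iff)
    then have "\<not> connected_component_of X x y"
      using td unfolding totally_disconnected_space_def connected_component_of_def by blast
    moreover have "quasi_component_of X x = connected_component_of X x"
      using X by (intro quasi_eq_connected_component_of) auto
    ultimately show ?thesis
      using that sub by (auto simp: separated_between_singletons)
  qed
  show ?thesis
    using sub pts
    by (auto simp: separated_between_pointwise_left[OF cp(1)]
        separated_between_pointwise_right[OF cp(2)])
qed

text \<open>The principal argument is discontinuous only at \<open>-1\<close>, and its rotation by \<open>\<pi>\<close> only at 1. A
  clopen set containing the fibre over \<open>-1\<close> and missing the fibre over 1 tells which one to use.\<close>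

lemma continuous_argument_if_totally_disconnected:
  assumes X: "compact_space X" "Hausdorff_space X" "totally_disconnected_space X"
    and u: "continuous_map X euclidean u" "\<And>x. x \<in> topspace X \<Longrightarrow> cmod (u x) = 1"
  obtains h where "continuous_map X euclideanreal h"
    "\<And>x. x \<in> topspace X \<Longrightarrow> u x = cis (h x)" "\<And>x. \<bar>h x\<bar> \<le> 2 * pi"
proof -
  let ?C = "\<lambda>c. {x \<in> topspace X. u x \<in> {c}}"
  have closed: "closedin X (?C c)" for c
    by (rule closedin_continuous_map_preimage[OF u(1)]) auto
  have "separated_between X (?C (-1)) (?C 1)"
    by (rule totally_disconnected_imp_separated_between[OF X closed closed])
       (auto simp: disjnt_iff)
  then obtain K where K: "closedin X K" "openin X K" "?C (-1) \<subseteq> K" "?C 1 \<subseteq> topspace X - K"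
    unfolding separated_between by blast
  define h where "h x = (if x \<in> K then pi + Arg (- u x) else Arg (u x))" for x
  show ?thesis
  proof
    have KX: "K \<subseteq> topspace X" using K closedin_subset by blast
    have clK: "X closure_of {x. x \<in> K} = K"
      using K by (simp add: closure_of_closedin)
    have clopen: "closedin X (topspace X - K)"
      using K by blast
    have clnK: "X closure_of {x. x \<notin> K} = topspace X - K"
    proof -
      have "topspace X \<inter> {x. x \<notin> K} = topspace X - K" by auto
      then have "X closure_of {x. x \<notin> K} = X closure_of (topspace X - K)"
        using closure_of_restrict[of X "{x. x \<notin> K}"] by simp
      then show ?thesis using clopen by (simp add: closure_of_closedin)
    qed
    have fr: "X frontier_of {x. x \<in> K} = {}"
      using K clopenin_eq_frontier_of[of X K] by simp
    show "continuous_map X euclideanreal h"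
      unfolding h_def
    proof (rule continuous_map_cases; (unfold clK clnK fr)?)
      show "continuous_map (subtopology X K) euclideanreal (\<lambda>x. pi + Arg (- u x))"
        using u K
        by (intro continuous_map_add continuous_map_Arg_unit continuous_map_minus
            continuous_map_from_subtopology) (auto simp: minus_equation_iff[of _ 1])
      show "continuous_map (subtopology X (topspace X - K)) euclideanreal (\<lambda>x. Arg (u x))"
        using u K
        by (intro continuous_map_Arg_unit continuous_map_from_subtopology) auto
    qed auto
    show "u x = cis (h x)" if "x \<in> topspace X" for x
      using u(2)[OF that] cis_Arg_unit[of "u x"] cis_Arg_unit[of "- u x"]
      by (simp add: h_def flip: cis_mult)
    show "\<bar>h x\<bar> \<le> 2 * pi" for x
      using Arg_bounded[of "u x"] Arg_bounded[of "- u x"] by (auto simp: h_def)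
  qed
qed

text \<open>The difference of two continuous arguments is continuous with values in the countable set
  \<open>2\<pi>\<int>\<close>, hence constant on connected sets.\<close>

lemma cis_lift_increment_unique:
  fixes g h :: "'a \<Rightarrow> real"
  assumes "connectedin X S" "continuous_map X euclideanreal g" "continuous_map X euclideanreal h"
    and eq: "\<And>x. x \<in> S \<Longrightarrow> cis (g x) = cis (h x)"
    and ab: "a \<in> S" "b \<in> S"
  shows "g b - g a = h b - h a"
proof -
  let ?d = "\<lambda>x. g x - h x"
  have "continuous_map X euclideanreal ?d"
    using assms by (intro continuous_map_diff)
  then have conn: "connected (?d ` S)"
    using connectedin_continuous_map_image[OF _ assms(1)] by force
  have "?d ` S \<subseteq> (\<lambda>n::int. 2 * pi * of_int n) ` UNIV"
  proof clarify
    fix x assume "x \<in> S"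
    then have "cis (?d x) = 1"
      using eq by (simp flip: cis_divide)
    then have "cos (?d x) = 1" by (simp add: complex_eq_iff)
    then show "?d x \<in> range (\<lambda>n::int. 2 * pi * of_int n)"
      by (auto simp: cos_one_2pi_int mult_ac)
  qed
  then have "countable (?d ` S)"
    by (rule countable_subset) simp
  then have "?d a = ?d b"
    using connected_uncountable[OF conn, of "?d a" "?d b"] ab by blast
  then show ?thesis by simp
qed

section \<open>Neighbourhoods of the identity and their powers\<close>

lemma (in group) set_power_subset_carrier:
  "V \<subseteq> carrier G \<Longrightarrow> set_power G V n \<subseteq> carrier G"
  by (induction n) (auto simp: set_mult_closed)

lemma unitary_carrier_one: "\<one>\<^bsub>unitary_group (C_alg X)\<^esub> \<in> carrier (unitary_group (C_alg X))"
  by (simp add: group.is_monoid monoid.one_closed unitary_group_C_alg_group)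

lemma cis_unitary:
  assumes "continuous_map X euclideanreal h"
  shows "(\<lambda>x\<in>topspace X. cis (h x)) \<in> carrier (unitary_group (C_alg X))"
proof -
  have "continuous_map X euclidean (\<lambda>x. cis (h x))"
    by (rule continuous_map_compose_open[OF assms, of UNIV]) (auto intro: continuous_intros)
  then have "continuous_map X euclidean (\<lambda>x\<in>topspace X. cis (h x))"
    by (rule continuous_map_eq) auto
  then show ?thesis
    by (simp add: C_alg_unitary_iff) (simp add: C_alg_def)
qed

text \<open>The next two lemmas describe the neighbourhoods of the identity through pointwise
  estimates, so that the supremum norm does not occur afterwards.\<close>

lemma unitary_neighbourhood_within:
  assumes X: "compact_space X" and e: "0 < e"
  obtains V where "openin (unitary_topology (C_alg X)) V"
    "\<one>\<^bsub>unitary_group (C_alg X)\<^esub> \<in> V"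
    "\<And>v x. v \<in> V \<Longrightarrow> x \<in> topspace X \<Longrightarrow> cmod (v x - 1) \<le> e"
proof -
  let ?A = "C_alg X"
  let ?U = "unitary_group ?A"
  interpret Metric_space "carrier ?A" "cstar_dist ?A" by (rule C_alg_Metric_space[OF X])
  have one: "\<one>\<^bsub>?U\<^esub> \<in> carrier ?A"
    using unitary_carrier_one C_alg_unitary_iff by blast
  show ?thesis
  proof
    show "openin (unitary_topology ?A) (mball \<one>\<^bsub>?U\<^esub> e \<inter> carrier ?U)"
      unfolding unitary_topology_def cstar_topology_def openin_subtopology
      using openin_mball by blast
    show "\<one>\<^bsub>?U\<^esub> \<in> mball \<one>\<^bsub>?U\<^esub> e \<inter> carrier ?U"
      using one e unitary_carrier_one by simp
    fix v x assume v: "v \<in> mball \<one>\<^bsub>?U\<^esub> e \<inter> carrier ?U" and x: "x \<in> topspace X"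
    then have "cstar_dist ?A v \<one>\<^bsub>?U\<^esub> \<le> e" "v \<in> carrier ?A"
      by (auto simp: commute)
    then show "cmod (v x - 1) \<le> e"
      using cstar_dist_C_alg_le_iff[OF X _ one, of v e] e x
      by (simp add: unitary_group_C_alg_simps)
  qed
qed

lemma unitary_neighbourhood_contains:
  assumes X: "compact_space X" and V: "openin (unitary_topology (C_alg X)) V"
    "\<one>\<^bsub>unitary_group (C_alg X)\<^esub> \<in> V"
  obtains e where "0 < e"
    "\<And>v. v \<in> carrier (unitary_group (C_alg X)) \<Longrightarrow>
      (\<And>x. x \<in> topspace X \<Longrightarrow> cmod (v x - 1) \<le> e) \<Longrightarrow> v \<in> V"
proof -
  let ?A = "C_alg X"
  let ?U = "unitary_group ?A"
  interpret Metric_space "carrier ?A" "cstar_dist ?A" by (rule C_alg_Metric_space[OF X])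
  have one: "\<one>\<^bsub>?U\<^esub> \<in> carrier ?A"
    using unitary_carrier_one C_alg_unitary_iff by blast
  obtain W where W: "openin mtopology W" "V = W \<inter> carrier ?U"
    using V(1) unfolding unitary_topology_def cstar_topology_def openin_subtopology by blast
  then obtain r where r: "r > 0" "mball \<one>\<^bsub>?U\<^esub> r \<subseteq> W"
    using V(2) unfolding openin_mtopology by blast
  show ?thesis
  proof
    show "0 < r / 2" using r by simp
    fix v assume v: "v \<in> carrier ?U"
      and le: "\<And>x. x \<in> topspace X \<Longrightarrow> cmod (v x - 1) \<le> r / 2"
    have vA: "v \<in> carrier ?A" using v C_alg_unitary_iff by blast
    have "cstar_dist ?A v \<one>\<^bsub>?U\<^esub> \<le> r / 2"
      using cstar_dist_C_alg_le_iff[OF X vA one, of "r/2"] le r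
      by (simp add: unitary_group_C_alg_simps)
    then have "v \<in> mball \<one>\<^bsub>?U\<^esub> r"
      using r one vA by (simp add: commute)
    then show "v \<in> V" using r W v by blast
  qed
qed

lemma set_power_cis:
  assumes "(\<lambda>x\<in>topspace X. cis (h x)) \<in> V"
  shows "(\<lambda>x\<in>topspace X. cis (real n * h x)) \<in> set_power (unitary_group (C_alg X)) V n"
proof (induction n)
  case (Suc n)
  have "(\<lambda>x\<in>topspace X. cis (real (Suc n) * h x)) =
      (\<lambda>x\<in>topspace X. cis (h x)) \<otimes>\<^bsub>unitary_group (C_alg X)\<^esub>
      (\<lambda>x\<in>topspace X. cis (real n * h x))"
    by (auto simp: unitary_group_C_alg_simps fun_eq_iff cis_mult algebra_simps)
  then show ?case
    using Suc assms unfolding set_power.simps set_mult_def by blast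
qed (simp add: unitary_group_C_alg_simps restrict_def)

text \<open>A unitary within distance 1 of the identity avoids the value \<open>-1\<close>, so its principal argument
  is continuous; arguments of the factors add up.\<close>

lemma set_power_bounded_argument:
  assumes V: "V \<subseteq> carrier (unitary_group (C_alg X))"
    "\<And>v x. v \<in> V \<Longrightarrow> x \<in> topspace X \<Longrightarrow> cmod (v x - 1) \<le> 1"
    and "u \<in> set_power (unitary_group (C_alg X)) V n"
  shows "\<exists>g. continuous_map X euclideanreal g \<and> (\<forall>x. \<bar>g x\<bar> \<le> real n * pi) \<and>
    (\<forall>x\<in>topspace X. u x = cis (g x))"
  using assms(3)
proof (induction n arbitrary: u)
  case 0
  then show ?case
    by (intro exI[where x = "\<lambda>x. 0"]) (auto simp: unitary_group_C_alg_simps)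
next
  case (Suc n)
  obtain v w where vw: "v \<in> V" "w \<in> set_power (unitary_group (C_alg X)) V n"
    "u = v \<otimes>\<^bsub>unitary_group (C_alg X)\<^esub> w"
    using Suc.prems by (auto simp: set_mult_def)
  obtain g where g: "continuous_map X euclideanreal g" "\<And>x. \<bar>g x\<bar> \<le> real n * pi"
    "\<And>x. x \<in> topspace X \<Longrightarrow> w x = cis (g x)"
    using Suc.IH[OF vw(2)] by blast
  have v: "continuous_map X euclidean v" "\<And>x. x \<in> topspace X \<Longrightarrow> cmod (v x) = 1"
    using vw(1) V(1) by (auto simp: C_alg_unitary_iff subset_iff) (auto simp: C_alg_def)
  have "v x \<noteq> -1" if "x \<in> topspace X" for x
    using V(2)[OF vw(1) that] by auto
  then have "continuous_map X euclideanreal (\<lambda>x. Arg (v x))"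
    using v by (intro continuous_map_Arg_unit) auto
  then have "continuous_map X euclideanreal (\<lambda>x. Arg (v x) + g x)"
    using g(1) by (rule continuous_map_add)
  moreover have "\<bar>Arg (v x) + g x\<bar> \<le> real (Suc n) * pi" for x
    using Arg_bounded[of "v x"] g(2)[of x]
    unfolding abs_le_iff by (auto simp: algebra_simps)
  moreover have "u x = cis (Arg (v x) + g x)" if "x \<in> topspace X" for x
    using that v(2) g(3) cis_Arg_unit[of "v x"]
    by (simp add: vw(3) unitary_group_C_alg_simps flip: cis_mult)
  ultimately show ?case by blast
qed

section \<open>Boundedness and total disconnectedness\<close>

lemma bounded_if_totally_disconnected:
  assumes X: "compact_space X" "Hausdorff_space X" and td: "totally_disconnected_space X"
  shows "topological_group.bounded_group (unitary_group (C_alg X)) (unitary_topology (C_alg X))"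
proof -
  let ?U = "unitary_group (C_alg X)"
  let ?T = "unitary_topology (C_alg X)"
  interpret topological_group ?U ?T
    by (rule unitary_group_C_alg_topological_group[OF X(1)])
  show ?thesis
    unfolding bounded_group_def
  proof (intro allI impI, elim conjE)
    fix V assume V: "openin ?T V" "\<one>\<^bsub>?U\<^esub> \<in> V"
    obtain e where e: "0 < e"
      "\<And>v. v \<in> carrier ?U \<Longrightarrow> (\<And>x. x \<in> topspace X \<Longrightarrow> cmod (v x - 1) \<le> e) \<Longrightarrow> v \<in> V"
      using unitary_neighbourhood_contains[OF X(1) V] by blast
    obtain n where n: "2 * pi / e < real n"
      using reals_Archimedean2 by blast
    have n0: "0 < real n"
    proof -
      have "0 < 2 * pi / e" using e(1) by simp
      then show ?thesis using n by linarith
    qed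
    have VU: "V \<subseteq> carrier ?U"
      using openin_subset[OF V(1)] unfolding topspace_eq .
    have all: "carrier ?U \<subseteq> set_power ?U V n"
    proof
      fix u assume u: "u \<in> carrier ?U"
      then have cu: "continuous_map X euclidean u" "\<And>x. x \<in> topspace X \<Longrightarrow> cmod (u x) = 1"
        "u \<in> extensional (topspace X)"
        by (auto simp: C_alg_unitary_iff) (auto simp: C_alg_def)
      obtain h where h: "continuous_map X euclideanreal h"
        "\<And>x. x \<in> topspace X \<Longrightarrow> u x = cis (h x)" "\<And>x. \<bar>h x\<bar> \<le> 2 * pi"
        using continuous_argument_if_totally_disconnected[OF X td cu(1,2)] by blast
      have "continuous_map X euclideanreal (\<lambda>x. h x / real n)"
        using n0 h(1) by (intro continuous_map_real_divide) auto
      then have v: "(\<lambda>x\<in>topspace X. cis (h x / real n)) \<in> carrier ?U"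
        by (rule cis_unitary)
      have "cmod (cis (h x / real n) - 1) \<le> e" for x
      proof -
        have "\<bar>h x / real n\<bar> \<le> 2 * pi / real n"
          using h(3)[of x] n0 by (simp add: divide_right_mono)
        also have "\<dots> \<le> e"
          using n n0 e(1) by (simp add: field_simps)
        finally show ?thesis
          using norm_cis_minus_one_le[of "h x / real n"] by linarith
      qed
      then have "(\<lambda>x\<in>topspace X. cis (h x / real n)) \<in> V"
        using e(2)[OF v] by simp
      from set_power_cis[OF this, of n]
      have "(\<lambda>x\<in>topspace X. cis (h x)) \<in> set_power ?U V n"
        using n0 by simp
      moreover have "u = (\<lambda>x\<in>topspace X. cis (h x))"
        using h(2) cu(3) by (auto intro: extensionalityI)
      ultimately show "u \<in> set_power ?U V n" by simp
    qed
    have sub: "set_power ?U V n \<subseteq> carrier ?U"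
      by (rule set_power_subset_carrier[OF VU])
    have "carrier ?U = set_power ?U V n <#>\<^bsub>?U\<^esub> {\<one>\<^bsub>?U\<^esub>}"
    proof
      show "carrier ?U \<subseteq> set_power ?U V n <#>\<^bsub>?U\<^esub> {\<one>\<^bsub>?U\<^esub>}"
      proof
        fix u assume u: "u \<in> carrier ?U"
        then have "u = u \<otimes>\<^bsub>?U\<^esub> \<one>\<^bsub>?U\<^esub>" by (simp only: r_one)
        then show "u \<in> set_power ?U V n <#>\<^bsub>?U\<^esub> {\<one>\<^bsub>?U\<^esub>}"
          using all u unfolding set_mult_def by blast
      qed
      show "set_power ?U V n <#>\<^bsub>?U\<^esub> {\<one>\<^bsub>?U\<^esub>} \<subseteq> carrier ?U"
        using sub by (intro set_mult_closed) auto
    qed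
    then show "\<exists>n F. finite F \<and> F \<subseteq> carrier ?U \<and> carrier ?U = set_power ?U V n <#>\<^bsub>?U\<^esub> F"
      by (intro exI[where x = n] exI[where x = "{\<one>\<^bsub>?U\<^esub>}"]) auto
  qed
qed

lemma totally_disconnected_if_bounded:
  assumes X: "compact_space X" "Hausdorff_space X"
    and bdd: "topological_group.bounded_group (unitary_group (C_alg X)) (unitary_topology (C_alg X))"
  shows "totally_disconnected_space X"
proof (rule ccontr)
  let ?U = "unitary_group (C_alg X)"
  let ?T = "unitary_topology (C_alg X)"
  interpret topological_group ?U ?T
    by (rule unitary_group_C_alg_topological_group[OF X(1)])
  assume "\<not> totally_disconnected_space X"
  then obtain S a b where S: "connectedin X S" "a \<in> S" "b \<in> S" "a \<noteq> b"
    unfolding totally_disconnected_space_def by blast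
  then have ab: "a \<in> topspace X" "b \<in> topspace X"
    using connectedin_subset_topspace by blast+
  have "normal_space X"
    using X compact_Hausdorff_or_regular_imp_normal_space by blast
  moreover have "closedin X {a}" "closedin X {b}"
    using X ab closedin_Hausdorff_singleton by metis+
  moreover have "disjnt {a} {b}" using S by simp
  ultimately obtain f where f: "continuous_map X euclideanreal f"
    "f ` {a} \<subseteq> {0}" "f ` {b} \<subseteq> {1}"
    by (rule Urysohn_lemma_alt[where a = 0 and b = 1])
  obtain V where V: "openin ?T V" "\<one>\<^bsub>?U\<^esub> \<in> V"
    "\<And>v x. v \<in> V \<Longrightarrow> x \<in> topspace X \<Longrightarrow> cmod (v x - 1) \<le> 1"
    using unitary_neighbourhood_within[OF X(1) zero_less_one] by blast
  then obtain n F where nF: "finite F" "F \<subseteq> carrier ?U"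
    "carrier ?U = set_power ?U V n <#>\<^bsub>?U\<^esub> F"
    using bdd[unfolded bounded_group_def, rule_format, OF conjI[OF V(1,2)]] by blast
  have VU: "V \<subseteq> carrier ?U"
    using openin_subset[OF V(1)] unfolding topspace_eq .
  \<comment> \<open>A quotient of two elements of \<open>V\<^sup>n\<close> has an argument bounded by \<open>2n\<pi>\<close>, which oscillates
    by at most \<open>4n\<pi>\<close>; distinct multiples of \<open>c\<close> differ by more than that.\<close>
  define c where "c = 4 * real n * pi + 1"
  define u where "u k = (\<lambda>x\<in>topspace X. cis (real k * c * f x))" for k :: nat
  have "\<exists>w\<in>F. \<exists>p\<in>set_power ?U V n. u k = p \<otimes>\<^bsub>?U\<^esub> w" for k
  proof -
    have "u k \<in> carrier ?U"
      unfolding u_def using f(1)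
      by (intro cis_unitary continuous_map_real_mult_left)
    then have "u k \<in> set_power ?U V n <#>\<^bsub>?U\<^esub> F"
      unfolding nF(3)[symmetric] .
    then show ?thesis
      unfolding set_mult_def by blast
  qed
  then have "\<forall>k. \<exists>w p. w \<in> F \<and> p \<in> set_power ?U V n \<and> u k = p \<otimes>\<^bsub>?U\<^esub> w"
    by blast
  then obtain w p where wp: "\<And>k. w k \<in> F" "\<And>k. p k \<in> set_power ?U V n"
    "\<And>k. u k = p k \<otimes>\<^bsub>?U\<^esub> w k"
    by metis
  have "\<not> inj w"
  proof
    assume "inj w"
    moreover have "finite (range w)"
      using nF(1) wp(1) by (intro finite_subset[of "range w" F]) auto
    ultimately show False
      using finite_imageD[of w UNIV] by simp
  qed
  then obtain i j where ij: "i \<noteq> j" "w i = w j"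
    by (auto simp: inj_def)
  have arg: "\<exists>g. continuous_map X euclideanreal g \<and> (\<forall>x. \<bar>g x\<bar> \<le> real n * pi) \<and>
      (\<forall>x\<in>topspace X. p k x = cis (g x))" for k
    by (rule set_power_bounded_argument[of V X "p k" n]) (use VU V(3) wp(2) in \<open>blast+\<close>)
  obtain g where g: "continuous_map X euclideanreal g" "\<And>x. \<bar>g x\<bar> \<le> real n * pi"
    "\<And>x. x \<in> topspace X \<Longrightarrow> p i x = cis (g x)"
    using arg[of i] by blast
  obtain h where h: "continuous_map X euclideanreal h" "\<And>x. \<bar>h x\<bar> \<le> real n * pi"
    "\<And>x. x \<in> topspace X \<Longrightarrow> p j x = cis (h x)"
    using arg[of j] by blast
  let ?l = "\<lambda>x. real i * c * f x - real j * c * f x"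
  have "?l b - ?l a = (g b - h b) - (g a - h a)"
  proof (rule cis_lift_increment_unique[OF S(1) _ _ _ S(2,3)])
    show "continuous_map X euclideanreal ?l"
      using f(1) by (intro continuous_map_diff continuous_map_real_mult_left)
    show "continuous_map X euclideanreal (\<lambda>x. g x - h x)"
      using g(1) h(1) by (intro continuous_map_diff)
    fix x assume "x \<in> S"
    then have x: "x \<in> topspace X"
      using S(1) connectedin_subset_topspace by blast
    have "w j \<in> carrier ?U" using wp(1) nF(2) by blast
    then have w0: "w j x \<noteq> 0"
      using x by (auto simp: C_alg_unitary_iff)
    have "cis (real i * c * f x) = cis (g x) * w j x"
      using fun_cong[OF wp(3)[of i], of x] x ij g(3)
      by (simp add: u_def unitary_group_C_alg_simps)
    moreover have "cis (real j * c * f x) = cis (h x) * w j x"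
      using fun_cong[OF wp(3)[of j], of x] x h(3)
      by (simp add: u_def unitary_group_C_alg_simps)
    ultimately show "cis (?l x) = cis (g x - h x)"
      using w0 by (simp flip: cis_divide)
  qed
  then have "(real i - real j) * c = (g b - h b) - (g a - h a)"
    using f by (simp add: algebra_simps)
  then have "\<bar>real i - real j\<bar> * \<bar>c\<bar> = \<bar>(g b - h b) - (g a - h a)\<bar>"
    by (metis abs_mult)
  also have "\<dots> \<le> 4 * real n * pi"
    using g(2)[of a] g(2)[of b] h(2)[of a] h(2)[of b] by linarith
  also have "\<dots> < c" by (simp add: c_def)
  also have "c \<le> \<bar>real i - real j\<bar> * \<bar>c\<bar>"
  proof -
    have "1 \<le> \<bar>real i - real j\<bar>" using ij(1) by linarith
    then have "1 * \<bar>c\<bar> \<le> \<bar>real i - real j\<bar> * \<bar>c\<bar>"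
      by (intro mult_right_mono) auto
    then show ?thesis by linarith
  qed
  finally show False by simp
qed

theorem proposition4p6:
  fixes X :: "'x topology"
  assumes "compact_space X" and "Hausdorff_space X"
  shows "topological_group.bounded_group (unitary_group (C_alg X)) (unitary_topology (C_alg X))
           \<longleftrightarrow> totally_disconnected_space X"
  using assms bounded_if_totally_disconnected totally_disconnected_if_bounded by blast

end
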